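(* Consider the data $Y$, $q$, $P$, $F$, $l(y,z)$, $F_z$, $\Phi$ defined in the context, and assume: (LICQ) for each $z\in F$ the Jacobian matrix $\nabla_y q(z)\in\mathbb{R}^{M\times N}$ has full row rank, i.e. $\operatorname{rank}\nabla_y q(z)=M$; and (Slater's condition) for each $z\in F$ the convex set $F_z$ contains interior points. Let $z^{(0)}\in F$ and let $\{z^{(k)}\}_{k\ge 0}$ be a sequence generated by $$z^{(k+1)}\in\operatorname*{argmin}_y\{P(y)\ |\ y\in F_{z^{(k)}}\},\qquad k=0,1,2,\dots$$ Then $z^{(k)}\in F$ for all $k$, and the sequence $\{z^{(k)}\}$ has a limit point $z^{*}\in F$ (the limit of some convergent subsequence) at which the sequence $\{P(z^{(k)})\}$ attains its minimum, i.e. $P(z^{*})=\inf_{k}P(z^{(k)})$. Moreover $P(z^{*})=\Phi(z^{*})$, i.e. $z^{*}$ is a minimizer of $P$ over $F_{z^{*}}$ (an optimum of the penalty problem $\min\{P(y)\ |\ y\in Y,\ q(y)\ge 0\}$ convexified at $z^{*}$).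
   Context: Setting. Let $n,m,s\ge 1$, $T\ge 2$ be integers. Let $X_i\subseteq\mathbb{R}^n$ ($i=1,\dots,T$) and $U_i\subseteq\mathbb{R}^m$ ($i=1,\dots,T-1$) be convex compact sets. Let $f:\mathbb{R}^n\times\mathbb{R}^m\to\mathbb{R}^n$ and $h:\mathbb{R}^n\to\mathbb{R}^s$ be $C^2$ with every component $f_j$ convex in $(x,u)$ jointly and every component $h_j$ convex. Put $y=(x_1^T,\dots,x_T^T,u_1^T,\dots,u_{T-1}^T)^T\in\mathbb{R}^N$, $N=m(T-1)+nT$, and let $Y\subseteq\mathbb{R}^N$ be the Cartesian product of all $X_i$ and $U_i$ (convex and compact). Let $g(y)=(g_1^T,\dots,g_{T-1}^T)^T\in\mathbb{R}^{n(T-1)}$ with $g_i=f(x_i,u_i)-x_{i+1}+x_i$, let $h(y)=(h(x_1)^T,\dots,h(x_T)^T)^T\in\mathbb{R}^{sT}$, and $q(y)=(g(y)^T,h(y)^T)^T\in\mathbb{R}^M$, $M=sT+n(T-1)$. Each component $q_j$ is thus convex and $C^2$. Vector inequalities are componentwise. $F=\{y\ |\ y\in Y,\ q(y)\ge 0\}$ (compact, in general not convex). Objective. $J:\mathbb{R}^N\to\mathbb{R}$ is continuous and convex, $\lambda\ge 0$, and $P(y)=J(y)+\lambda\|g(y)\|_1$. (On $F$, where $g\ge 0$, $P$ coincides with the convex function $J+\lambda\sum_j g_j$, the sum being over components of $g$.) Projection and linearization. Each set $\{y\in\mathbb{R}^N\ |\ q_j(y)\le 0\}$ is assumed nonempty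 (it is closed and convex). For $z\in F$ and $j=1,\dots,M$, $\bar z_j$ is the unique minimizer of $\|z-y\|_2$ over $\{y\ |\ q_j(y)\le 0\}$; it satisfies $q_j(\bar z_j)=0$. Set $l_j(y,z)=\nabla_y q_j(\bar z_j)(y-\bar z_j)$, where $\nabla_y q_j$ is the gradient as a row vector, $l(y,z)=(l_1(y,z),\dots,l_M(y,z))^T$, and $F_z=\{y\ |\ y\in Y,\ l(y,z)\ge 0\}$ (convex and compact). Finally, for $z\in F$, $\Phi(z)=\min_y\{P(y)\ |\ y\in F_z\}$. *)

theory Defs
  imports "HOL-Analysis.Analysis"
begin

section \<open>Time stages\<close>

text \<open>Time instants are the elements of a finite linearly ordered type, numbered from \<open>1\<close>
  in increasing order. The states use a type with \<open>T\<close> elements, the controls one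
  with \<open>T - 1\<close> elements.\<close>

definition stage :: "'a::{finite,linorder} \<Rightarrow> nat"
  where "stage a = card {..a}"

definition at_stage :: "nat \<Rightarrow> 'a::{finite,linorder}"
  where "at_stage = inv stage"

lemma inj_stage: "inj (stage :: 'a::{finite,linorder} \<Rightarrow> nat)"
proof (rule linorder_injI)
  fix a b :: 'a
  assume "a < b"
  then have "{..a} \<subset> {..b}" by auto
  then have "card {..a} < card {..b}" by (intro psubset_card_mono) auto
  then show "stage a \<noteq> stage b" by (simp add: stage_def)
qed

lemma range_stage: "range (stage :: 'a::{finite,linorder} \<Rightarrow> nat) = {1..CARD('a)}"
proof (rule card_subset_eq)
  have "1 \<le> stage a" for a :: 'a
    using card_gt_0_iff[of "{..a}"] by (auto simp: stage_def Suc_le_eq)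
  then show "range (stage :: 'a \<Rightarrow> nat) \<subseteq> {1..CARD('a)}"
    by (auto simp: stage_def card_mono)
  show "card (range (stage :: 'a \<Rightarrow> nat)) = card {1..CARD('a)}"
    by (simp add: card_image inj_stage)
qed simp

lemma at_stage_stage [simp]: "at_stage (stage a) = a"
  by (simp add: at_stage_def inj_stage)

lemma stage_at_stage: "i \<in> {1..CARD('a)} \<Longrightarrow> stage (at_stage i :: 'a::{finite,linorder}) = i"
  by (metis at_stage_def f_inv_into_f range_stage)


section \<open>Variables, constraints and objective\<close>

text \<open>The vector \<open>y\<close> of all states and controls. Here \<open>'t\<close> and \<open>'u\<close> index the time instants of
  states and controls, \<open>'n\<close> and \<open>'m\<close> the components of a state and of a control.\<close>

type_synonym ('t, 'n, 'u, 'm) decision = "real ^ (('t \<times> 'n) + ('u \<times> 'm))"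

definition state :: "('t::{finite,linorder}, 'n::finite, 'u::{finite,linorder}, 'm::finite) decision
    \<Rightarrow> nat \<Rightarrow> real ^ 'n"
  where "state y i = (\<chi> a. y $ Inl (at_stage i, a))"

definition control :: "('t::{finite,linorder}, 'n::finite, 'u::{finite,linorder}, 'm::finite) decision
    \<Rightarrow> nat \<Rightarrow> real ^ 'm"
  where "control y i = (\<chi> b. y $ Inr (at_stage i, b))"

definition box_set :: "(nat \<Rightarrow> (real ^ 'n) set) \<Rightarrow> (nat \<Rightarrow> (real ^ 'm) set)
    \<Rightarrow> ('t::{finite,linorder}, 'n::finite, 'u::{finite,linorder}, 'm::finite) decision set"
  where "box_set X U = {y. (\<forall>i\<in>{1..CARD('t)}. state y i \<in> X i) \<and>
                           (\<forall>i\<in>{1..CARD('u)}. control y i \<in> U i)}"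

definition dyn :: "((real ^ 'n) \<times> (real ^ 'm) \<Rightarrow> real ^ 'n)
    \<Rightarrow> ('t::{finite,linorder}, 'n::finite, 'u::{finite,linorder}, 'm::finite) decision
    \<Rightarrow> nat \<Rightarrow> real ^ 'n"
  where "dyn f y i = f (state y i, control y i) - state y (i + 1) + state y i"

definition dyn_vec :: "((real ^ 'n) \<times> (real ^ 'm) \<Rightarrow> real ^ 'n)
    \<Rightarrow> ('t::{finite,linorder}, 'n::finite, 'u::{finite,linorder}, 'm::finite) decision
    \<Rightarrow> real ^ ('u \<times> 'n)"
  where "dyn_vec f y = (\<chi> k. dyn f y (stage (fst k)) $ snd k)"

definition path_vec :: "(real ^ 'n \<Rightarrow> real ^ 's)
    \<Rightarrow> ('t::{finite,linorder}, 'n::finite, 'u::{finite,linorder}, 'm::finite) decision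
    \<Rightarrow> real ^ ('t \<times> 's::finite)"
  where "path_vec h y = (\<chi> k. h (state y (stage (fst k))) $ snd k)"

definition constr :: "((real ^ 'n) \<times> (real ^ 'm) \<Rightarrow> real ^ 'n) \<Rightarrow> (real ^ 'n \<Rightarrow> real ^ 's)
    \<Rightarrow> ('t::{finite,linorder}, 'n::finite, 'u::{finite,linorder}, 'm::finite) decision
    \<Rightarrow> real ^ (('u \<times> 'n) + ('t \<times> 's::finite))"
  where "constr f h y =
    (\<chi> j. case j of Inl k \<Rightarrow> dyn_vec f y $ k | Inr k \<Rightarrow> path_vec h y $ k)"

definition l1_norm :: "real ^ 'k \<Rightarrow> real"
  where "l1_norm v = (\<Sum>i\<in>UNIV. \<bar>v $ i\<bar>)"

definition penalty :: "(('t::{finite,linorder}, 'n::finite, 'u::{finite,linorder}, 'm::finite) decision \<Rightarrow> real)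
    \<Rightarrow> real \<Rightarrow> ((real ^ 'n) \<times> (real ^ 'm) \<Rightarrow> real ^ 'n) \<Rightarrow> ('t, 'n, 'u, 'm) decision \<Rightarrow> real"
  where "penalty J lam f y = J y + lam * l1_norm (dyn_vec f y)"

definition C2 :: "('a::real_normed_vector \<Rightarrow> 'b::real_normed_vector) \<Rightarrow> bool"
  where "C2 \<phi> \<longleftrightarrow>
    (\<exists>(D :: 'a \<Rightarrow> 'a \<Rightarrow>\<^sub>L 'b) (D2 :: 'a \<Rightarrow> 'a \<Rightarrow>\<^sub>L ('a \<Rightarrow>\<^sub>L 'b)).
       (\<forall>x. (\<phi> has_derivative blinfun_apply (D x)) (at x)) \<and>
       (\<forall>x. (D has_derivative blinfun_apply (D2 x)) (at x)) \<and>
       continuous_on UNIV D2)"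


section \<open>Convexified feasible sets\<close>

text \<open>The order on real vectors is the componentwise one.\<close>

definition feasible :: "(real ^ 'k) set \<Rightarrow> (real ^ 'k \<Rightarrow> real ^ 'l) \<Rightarrow> (real ^ 'k) set"
  where "feasible Y q = {y. y \<in> Y \<and> 0 \<le> q y}"

definition proj :: "(real ^ 'k \<Rightarrow> real ^ 'l) \<Rightarrow> 'l \<Rightarrow> real ^ 'k \<Rightarrow> real ^ 'k"
  where "proj q j z = closest_point {y. q y $ j \<le> 0} z"

text \<open>Row \<open>j\<close> of the Jacobian of \<open>q\<close> is the gradient of the component \<open>q\<^sub>j\<close>.\<close>

definition lin :: "(real ^ 'k \<Rightarrow> real ^ 'l) \<Rightarrow> real ^ 'k \<Rightarrow> real ^ 'k \<Rightarrow> real ^ 'l"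
  where "lin q y z = (\<chi> j. row j (jacobian q (at (proj q j z))) \<bullet> (y - proj q j z))"

definition convexified :: "(real ^ 'k) set \<Rightarrow> (real ^ 'k \<Rightarrow> real ^ 'l) \<Rightarrow> real ^ 'k \<Rightarrow> (real ^ 'k) set"
  where "convexified Y q z = {y. y \<in> Y \<and> 0 \<le> lin q y z}"

text \<open>On a nonempty compact \<open>convexified Y q z\<close> and for continuous \<open>P\<close> this infimum is attained, so
  it is the minimum.\<close>

definition opt_value :: "(real ^ 'k \<Rightarrow> real) \<Rightarrow> (real ^ 'k) set \<Rightarrow> (real ^ 'k \<Rightarrow> real ^ 'l)
    \<Rightarrow> real ^ 'k \<Rightarrow> real"
  where "opt_value P Y q z = (INF y\<in>convexified Y q z. P y)"

end

theory Submission
  imports Defs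
begin

text \<open>Convexity puts each component above its tangents, so \<open>F\<^sub>z \<subseteq> F\<close>. Moving from the
  projection of \<open>z\<close> towards \<open>z\<close> leaves the sublevel set at once, so \<open>q\<^sub>j\<close> does not decrease
  initially, which gives \<open>z \<in> F\<^sub>z\<close>. Hence the values \<open>P z\<^sub>k\<close> decrease. Let \<open>w\<close> be a limit point of
  the iterates, let \<open>y \<in> F\<^sub>w\<close> and let \<open>y\<^sub>0\<close> be an interior point of \<open>F\<^sub>w\<close>. The points
  \<open>(1 - t) y + t y\<^sub>0\<close> with \<open>t > 0\<close> satisfy all nontrivial linearized constraints strictly, so by
  continuity of the projections they are feasible for the subproblems near \<open>w\<close>. Comparing
  values and letting \<open>t \<rightarrow> 0\<close> yields \<open>P w \<le> P y\<close>.\<close>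

section \<open>Derivatives and tangents of convex constraints\<close>

locale convex_constraints =
  fixes q :: "real ^ 'k \<Rightarrow> real ^ 'l" and q' :: "real ^ 'k \<Rightarrow> real ^ 'k \<Rightarrow> real ^ 'l"
  assumes convex_component: "\<And>j. convex_on UNIV (\<lambda>x. q x $ j)"
    and deriv: "\<And>x. (q has_derivative q' x) (at x)"
    and continuous_deriv: "\<And>v. continuous_on UNIV (\<lambda>x. q' x v)"
    and sublevel_nonempty: "\<And>j. {y. q y $ j \<le> 0} \<noteq> {}"
begin

lemma continuous_on_q: "continuous_on S q"
  using has_derivative_continuous[OF deriv] by (simp add: continuous_at_imp_continuous_on)

text \<open>Uniqueness of the derivative lets the matrix rows in \<open>lin\<close> be exchanged for
  the map \<open>q'\<close>, which is easier to compute with.\<close>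

lemma row_jacobian_inner: "row j (jacobian q (at x)) \<bullet> v = q' x v $ j"
proof -
  have "(q has_derivative (\<lambda>v. jacobian q (at x) *v v)) (at x)"
    using deriv differentiable_def jacobian_works by blast
  then have "q' x = (\<lambda>v. jacobian q (at x) *v v)"
    using deriv has_derivative_unique by blast
  then show ?thesis
    by (simp add: matrix_vector_mul_component row_def vec_lambda_eta)
qed

lemma lin_component: "lin q y z $ j = q' (proj q j z) (y - proj q j z) $ j"
  by (simp add: lin_def row_jacobian_inner)

text \<open>Finitely many directions determine a row, so continuity of \<open>q'\<close> in the base
  point for each fixed direction makes the rows continuous.\<close>

lemma row_jacobian_eq: "row j (jacobian q (at x)) = (\<chi> i. q' x (axis i 1) $ j)"
  by (simp add: vec_eq_iff inner_axis flip: row_jacobian_inner)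

lemma continuous_on_row_jacobian: "continuous_on UNIV (\<lambda>x. row j (jacobian q (at x)))"
  unfolding row_jacobian_eq
  by (intro continuous_on_vec_lambda continuous_on_component continuous_deriv)

lemma line_deriv:
  "((\<lambda>t. q (x + t *\<^sub>R v) $ j) has_real_derivative q' x v $ j) (at 0)"
proof -
  have l: "linear (q' x)" by (rule has_derivative_linear[OF deriv])
  have "((\<lambda>t. x + t *\<^sub>R v) has_derivative (\<lambda>t. t *\<^sub>R v)) (at 0)"
    by (auto intro!: derivative_eq_intros)
  moreover have "(q has_derivative q' x) (at (x + 0 *\<^sub>R v))"
    using deriv by simp
  ultimately have "((\<lambda>t. q (x + t *\<^sub>R v)) has_derivative (\<lambda>t. q' x (t *\<^sub>R v))) (at 0)"
    by (rule has_derivative_compose)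
  then have "((\<lambda>t. q (x + t *\<^sub>R v) $ j) has_derivative (\<lambda>t. q' x (t *\<^sub>R v) $ j)) (at 0)"
    by (rule bounded_linear.has_derivative[OF bounded_linear_vec_nth])
  then show ?thesis
    by (simp add: has_field_derivative_def linear_cmul[OF l] mult_commute_abs)
qed

text \<open>Restriction to the line through \<open>x\<close> and \<open>y\<close> reduces this to
  one real variable: tangent at parameter 0, evaluated at parameter 1.\<close>

lemma tangent_le: "q x $ j + q' x (y - x) $ j \<le> q y $ j"
proof -
  let ?f = "\<lambda>t. q (x + t *\<^sub>R (y - x)) $ j"
  have "convex_on UNIV ?f"
  proof (rule convex_onI)
    fix t a b :: real
    assume t: "0 < t" "t < 1"
    have "x + ((1 - t) *\<^sub>R a + t *\<^sub>R b) *\<^sub>R (y - x)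
        = (1 - t) *\<^sub>R (x + a *\<^sub>R (y - x)) + t *\<^sub>R (x + b *\<^sub>R (y - x))"
      by (simp add: algebra_simps)
    then show "?f ((1 - t) *\<^sub>R a + t *\<^sub>R b) \<le> (1 - t) * ?f a + t * ?f b"
      using convex_onD[OF convex_component, of t] t by simp
  qed simp
  from convex_on_imp_above_tangent[OF this connected_UNIV _ UNIV_I line_deriv, of 1]
  show ?thesis by simp
qed

section \<open>Projections onto the sublevel sets\<close>

lemma convex_sublevel: "convex {y. q y $ j \<le> 0}"
  unfolding convex_alt
proof (intro ballI allI impI, simp only: mem_Collect_eq)
  fix x y and t :: real
  assume le: "q x $ j \<le> 0" "q y $ j \<le> 0" and t: "0 \<le> t \<and> t \<le> 1"
  have "q ((1 - t) *\<^sub>R x + t *\<^sub>R y) $ j \<le> (1 - t) * q x $ j + t * q y $ j"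
    using t by (intro convex_onD[OF convex_component]) auto
  also have "\<dots> \<le> 0"
    using le t by (intro add_nonpos_nonpos mult_nonneg_nonpos) auto
  finally show "q ((1 - t) *\<^sub>R x + t *\<^sub>R y) $ j \<le> 0" .
qed

lemma closed_sublevel: "closed {y. q y $ j \<le> 0}"
  by (intro closed_Collect_le continuous_intros continuous_on_q)

lemma proj_sublevel: "q (proj q j z) $ j \<le> 0"
  using closest_point_in_set[OF closed_sublevel sublevel_nonempty]
  by (auto simp: proj_def)

lemma continuous_on_proj: "continuous_on S (proj q j)"
  unfolding proj_def
  using continuous_on_closest_point[OF convex_sublevel closed_sublevel sublevel_nonempty] by simp

lemma continuous_on_lin: "continuous_on S (\<lambda>z. lin q y z $ j)"
  unfolding lin_def vec_lambda_beta
  by (intro continuous_intros continuous_on_proj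
      continuous_on_compose2[OF continuous_on_row_jacobian]) auto

text \<open>Any other conclusion would put a point of the sublevel set strictly closer to
  \<open>z\<close> than its projection.\<close>

lemma segment_pos:
  assumes "0 \<le> q z $ j" "0 < t" "t \<le> 1" "z \<noteq> proj q j z"
  shows "0 < q (proj q j z + t *\<^sub>R (z - proj q j z)) $ j"
proof (rule ccontr)
  let ?p = "proj q j z"
  let ?w = "?p + t *\<^sub>R (z - ?p)"
  assume "\<not> ?thesis"
  then have "dist z ?p \<le> dist z ?w"
    unfolding proj_def by (intro closest_point_le closed_sublevel) (simp add: proj_def)
  also have "z - ?w = (1 - t) *\<^sub>R (z - ?p)"
    by (simp add: algebra_simps)
  then have "dist z ?w = (1 - t) * dist z ?p"
    using assms by (simp add: dist_norm)
  finally have "t * dist z ?p \<le> 0"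
    by (simp add: algebra_simps)
  moreover have "0 < t * dist z ?p"
    using assms by simp
  ultimately show False by simp
qed

lemma
  assumes "0 \<le> q z $ j"
  shows proj_zero: "q (proj q j z) $ j = 0"
    and lin_self_nonneg: "0 \<le> lin q z z $ j"
proof -
  let ?p = "proj q j z"
  have "q ?p $ j = 0 \<and> 0 \<le> lin q z z $ j"
  proof (cases "z = ?p")
    case True
    \<comment> \<open>Here \<open>z\<close> itself lies in the sublevel set, so both sign conditions
      force \<open>q z $ j = 0\<close>, and the linearization at \<open>z\<close> is the derivative
      in direction 0.\<close>
    have "q' ?p 0 = 0" by (rule linear_0[OF has_derivative_linear[OF deriv]])
    then show ?thesis
      using True proj_sublevel[of j z] assms unfolding lin_component by simp
  next
    case False
    let ?f = "\<lambda>t. q (?p + t *\<^sub>R (z - ?p)) $ j"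
    have pos: "eventually (\<lambda>t. 0 < ?f t) (at_right 0)"
      unfolding eventually_at_right_field
      using segment_pos[OF assms _ _ False] by (intro exI[of _ 1]) auto
    \<comment> \<open>The values just to the right of 0 are positive, so the value at the projection
      is nonnegative; membership in the sublevel set gives the reverse bound.\<close>
    have "isCont ?f 0"
      using line_deriv DERIV_isCont by blast
    then have "(?f \<longlongrightarrow> ?f 0) (at_right 0)"
      unfolding isCont_def by (rule tendsto_mono[OF at_le[OF subset_UNIV]])
    then have "0 \<le> ?f 0"
      by (rule tendsto_lowerbound) (use pos in \<open>simp_all add: eventually_mono[OF _ less_imp_le]\<close>)
    then have zero: "q ?p $ j = 0"
      using proj_sublevel[of j z] by simp
    \<comment> \<open>Since \<open>?f 0 = 0\<close>, the right difference quotients are positive,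
      and so their limit is nonnegative.\<close>
    have "((\<lambda>t. (?f (0 + t) - ?f 0) / t) \<longlongrightarrow> q' ?p (z - ?p) $ j) (at 0)"
      using line_deriv[of ?p "z - ?p" j] unfolding DERIV_def .
    then have "((\<lambda>t. (?f (0 + t) - ?f 0) / t) \<longlongrightarrow> q' ?p (z - ?p) $ j) (at_right 0)"
      by (rule tendsto_mono[OF at_le[OF subset_UNIV]])
    then have "0 \<le> q' ?p (z - ?p) $ j"
    proof (rule tendsto_lowerbound)
      show "eventually (\<lambda>t. 0 \<le> (?f (0 + t) - ?f 0) / t) (at_right 0)"
        using pos eventually_at_right_less[of "0::real"]
        by eventually_elim (simp add: zero)
    qed simp
    then show ?thesis
      using zero by (simp add: lin_component)
  qed
  then show "q ?p $ j = 0" "0 \<le> lin q z z $ j" by auto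
qed

section \<open>Properties of the convexified feasible sets\<close>

text \<open>As \<open>q\<close> vanishes in component \<open>j\<close> at the projection, the
  linearization is the full tangent there and bounds that component from below.\<close>

lemma convexified_subset_feasible:
  assumes "z \<in> feasible Y q"
  shows "convexified Y q z \<subseteq> feasible Y q"
proof
  fix y assume y: "y \<in> convexified Y q z"
  have "0 \<le> q y $ j" for j
  proof -
    have "0 \<le> lin q y z $ j"
      using y by (simp add: convexified_def less_eq_vec_def)
    moreover have "q (proj q j z) $ j = 0"
      using assms by (intro proj_zero) (simp add: feasible_def less_eq_vec_def)
    ultimately show ?thesis
      using tangent_le[of "proj q j z" j y] by (simp add: lin_component)
  qed
  then show "y \<in> feasible Y q"
    using y by (simp add: feasible_def convexified_def less_eq_vec_def)
qed

lemma in_own_convexified: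
  assumes "z \<in> feasible Y q"
  shows "z \<in> convexified Y q z"
  using assms lin_self_nonneg by (simp add: feasible_def convexified_def less_eq_vec_def)

text \<open>A vanishing gradient at a projected point means that \<open>q\<^sub>j\<close> attains its minimum \<open>0\<close> there.
  Then every projection is a minimizer of \<open>q\<^sub>j\<close> as well, and constraint \<open>j\<close> is void in
  every convexification.\<close>

lemma lin_zero_if_gradient_zero:
  assumes "0 \<le> q z $ j" and "row j (jacobian q (at (proj q j z))) = 0"
  shows "lin q y w $ j = 0"
proof -
  have q0: "0 \<le> q x $ j" for x
    using tangent_le[of "proj q j z" j x] proj_zero[OF assms(1)] assms(2)
    by (simp flip: row_jacobian_inner)
  have "((\<lambda>x. q x $ j) has_derivative (\<lambda>v. q' (proj q j w) v $ j)) (at (proj q j w))"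
    by (rule bounded_linear.has_derivative[OF bounded_linear_vec_nth deriv])
  then have "(\<lambda>v. q' (proj q j w) v $ j) = (\<lambda>v. 0)"
    by (rule differential_zero_maxmin[OF UNIV_I open_UNIV])
       (intro disjI2 ballI order_trans[OF proj_sublevel q0])
  then have "q' (proj q j w) v $ j = 0" for v
    by (rule fun_cong)
  then show ?thesis
    by (simp add: lin_component)
qed

text \<open>A short step against the gradient stays in the set, yet strictly lowers the
  linearization, which must remain nonnegative.\<close>

lemma lin_pos_interior:
  assumes "y \<in> interior (convexified Y q z)" and "row j (jacobian q (at (proj q j z))) \<noteq> 0"
  shows "0 < lin q y z $ j"
proof -
  let ?g = "row j (jacobian q (at (proj q j z)))"
  obtain e where e: "0 < e" "cball y e \<subseteq> convexified Y q z"
    using assms(1) mem_interior_cball by blast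
  \<comment> \<open>The factor gives the step length exactly \<open>e\<close>, so the closed ball
    contains the new point.\<close>
  let ?y = "y - (e / norm ?g) *\<^sub>R ?g"
  have "?y \<in> cball y e"
    using e(1) assms(2) by (simp add: dist_norm)
  then have "?y \<in> convexified Y q z"
    using e(2) by blast
  then have "0 \<le> lin q ?y z $ j"
    by (simp add: convexified_def less_eq_vec_def)
  also have "lin q ?y z $ j = lin q y z $ j - (e / norm ?g) * (?g \<bullet> ?g)"
    by (simp add: lin_def inner_diff_right)
  also have "\<dots> < lin q y z $ j"
    using e(1) assms(2) by simp
  finally show ?thesis .
qed

lemma lin_convex_combination:
  "lin q ((1 - t) *\<^sub>R x + t *\<^sub>R y) z $ j = (1 - t) * lin q x z $ j + t * lin q y z $ j"
  by (simp add: lin_def inner_diff_right inner_add_right algebra_simps)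

section \<open>Limit points of the iteration\<close>

lemma limit_point_optimal:
  assumes Y: "convex Y" "compact Y" and P: "continuous_on UNIV P"
    and Slater: "\<And>w. w \<in> feasible Y q \<Longrightarrow> interior (convexified Y q w) \<noteq> {}"
    and z0: "z 0 \<in> feasible Y q"
    and step: "\<And>k. is_arg_min P (\<lambda>y. y \<in> convexified Y q (z k)) (z (Suc k))"
  shows "(\<forall>k. z k \<in> feasible Y q) \<and>
    (\<exists>zs\<in>feasible Y q. (\<exists>r :: nat \<Rightarrow> nat. strict_mono r \<and> (z \<circ> r) \<longlonglongrightarrow> zs) \<and>
       P zs = (INF k. P (z k)) \<and>
       P zs = opt_value P Y q zs \<and>
       is_arg_min P (\<lambda>y. y \<in> convexified Y q zs) zs)"
proof -
  have F: "z k \<in> feasible Y q" for k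
  proof (induction k)
    case (Suc k)
    then show ?case
      using step[of k] convexified_subset_feasible by (auto simp: is_arg_min_def)
  qed (rule z0)
  have "closed {y. 0 \<le> q y}"
    unfolding less_eq_vec_def
    by (intro closed_Collect_all closed_Collect_le continuous_intros continuous_on_q)
  then have "compact (feasible Y q)"
    unfolding feasible_def using compact_Int_closed[OF Y(2)]
    by (simp add: Collect_conj_eq)
  then obtain zs r where zs: "zs \<in> feasible Y q" and r: "strict_mono r" "(z \<circ> r) \<longlonglongrightarrow> zs"
    using F unfolding compact_def by metis
  have le: "P (z (Suc k)) \<le> P y" if "y \<in> convexified Y q (z k)" for k y
    using step[of k] that by (auto simp: is_arg_min_def not_less)
  have dec: "decseq (\<lambda>k. P (z k))"
    by (intro decseq_SucI le in_own_convexified F)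
  \<comment> \<open>A real \<open>INF\<close> is a true infimum only for nonempty sets bounded
    below; compactness of \<open>Y\<close> supplies the bound.\<close>
  have PYb: "bdd_below (P ` Y)"
    using Y(2) P by (meson bounded_imp_bdd_below compact_continuous_image compact_imp_bounded
        continuous_on_subset subset_UNIV)
  have bdd: "bdd_below (range (\<lambda>k. P (z k)))"
    by (rule bdd_below_mono[OF PYb]) (use F in \<open>auto simp: feasible_def\<close>)
  have "(\<lambda>k. P (z k)) \<longlonglongrightarrow> (INF k. P (z k))"
    by (rule LIMSEQ_decseq_INF[OF bdd dec])
  then have "(\<lambda>k. P (z (r k))) \<longlonglongrightarrow> (INF k. P (z k))"
    using LIMSEQ_subseq_LIMSEQ[OF _ r(1)] by (auto simp: o_def)
  moreover have "(\<lambda>k. P (z (r k))) \<longlonglongrightarrow> P zs"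
    using continuous_on_tendsto_compose[OF P r(2)] by (simp add: o_def)
  \<comment> \<open>Monotonicity makes all values converge to the infimum, and continuity of
    \<open>P\<close> identifies the limit along the subsequence.\<close>
  ultimately have inf: "P zs = (INF k. P (z k))"
    using LIMSEQ_unique by blast
  have opt: "P zs \<le> P y" if y: "y \<in> convexified Y q zs" for y
  proof -
    obtain y0 where y0: "y0 \<in> interior (convexified Y q zs)"
      using Slater[OF zs] by blast
    let ?y = "\<lambda>t. (1 - t) *\<^sub>R y + t *\<^sub>R y0"
    have y0Y: "y0 \<in> Y" and yY: "y \<in> Y" and ly: "\<And>j. 0 \<le> lin q y zs $ j"
      using y0 interior_subset y by (auto simp: convexified_def less_eq_vec_def)
    have below: "P zs \<le> P (?y t)" if t: "0 < t" "t < 1" for t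
    proof -
      \<comment> \<open>A constraint with zero gradient at the limit is identically zero at all
        iterates; any other is strictly positive at \<open>?y t\<close>, which survives small
        changes of the base point.\<close>
      have ev: "eventually (\<lambda>k. 0 \<le> lin q (?y t) (z (r k)) $ j) sequentially" for j
      proof (cases "row j (jacobian q (at (proj q j zs))) = 0")
        case True
        have "0 \<le> q zs $ j" using zs by (simp add: feasible_def less_eq_vec_def)
        from lin_zero_if_gradient_zero[OF this True] show ?thesis by simp
      next
        case False
        have pos: "0 < lin q (?y t) zs $ j"
          unfolding lin_convex_combination
          using lin_pos_interior[OF y0 False] ly[of j] t by (simp add: add_nonneg_pos)
        have "(\<lambda>k. lin q (?y t) (z (r k)) $ j) \<longlonglongrightarrow> lin q (?y t) zs $ j"
          using continuous_on_tendsto_compose[OF continuous_on_lin[of UNIV] r(2)]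
          by (simp add: o_def)
        from order_tendstoD(1)[OF this pos] show ?thesis
          by (rule eventually_mono) simp
      qed
      \<comment> \<open>There are only finitely many constraints, so one index serves them
        all.\<close>
      have "eventually (\<lambda>k. \<forall>j. 0 \<le> lin q (?y t) (z (r k)) $ j) sequentially"
        using ev by (simp add: eventually_all_finite)
      then obtain k where k: "\<forall>j. 0 \<le> lin q (?y t) (z (r k)) $ j"
        by (auto simp: eventually_sequentially)
      have "?y t \<in> Y"
        using Y(1) yY y0Y t by (simp add: convex_alt)
      \<comment> \<open>The minimizer for base point \<open>z (r k)\<close> is
        \<open>z (Suc (r k))\<close>, which may lie off the subsequence; the infimum over all
        iterates still bounds its value from below.\<close>
      with k have "P (z (Suc (r k))) \<le> P (?y t)"
        by (intro le) (simp add: convexified_def less_eq_vec_def)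
      then show ?thesis
        using cINF_lower[OF bdd, of "Suc (r k)"] inf by simp
    qed
    have "((\<lambda>t. P (?y t)) \<longlongrightarrow> P (?y 0)) (at_right 0)"
      by (rule continuous_on_tendsto_compose[OF P]) (auto intro!: tendsto_eq_intros)
    then have "P zs \<le> P (?y 0)"
      by (rule tendsto_lowerbound)
         (use below in \<open>auto simp: eventually_at_right_field intro!: exI[of _ 1]\<close>)
    then show ?thesis by simp
  qed
  have zs_in: "zs \<in> convexified Y q zs"
    by (rule in_own_convexified[OF zs])
  have "P zs = opt_value P Y q zs"
    unfolding opt_value_def using zs_in opt
    by (intro cInf_eq_minimum[symmetric]) auto
  moreover have "is_arg_min P (\<lambda>y. y \<in> convexified Y q zs) zs"
    using zs_in opt by (auto simp: is_arg_min_def not_less)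
  ultimately show ?thesis
    using F zs r inf by blast
qed

end

section \<open>Convexity, compactness and smoothness of the control problem\<close>

lemma bounded_linear_state: "bounded_linear (\<lambda>y. state y i)"
  unfolding state_def
  by (intro linear_conv_bounded_linear[THEN iffD1] linearI) (auto simp: vec_eq_iff)

lemma bounded_linear_control: "bounded_linear (\<lambda>y. control y i)"
  unfolding control_def
  by (intro linear_conv_bounded_linear[THEN iffD1] linearI) (auto simp: vec_eq_iff)

lemmas state_linear_simps =
  linear_add[OF bounded_linear.linear[OF bounded_linear_state]]
  linear_cmul[OF bounded_linear.linear[OF bounded_linear_state]]
lemmas control_linear_simps =
  linear_add[OF bounded_linear.linear[OF bounded_linear_control]]
  linear_cmul[OF bounded_linear.linear[OF bounded_linear_control]]

lemma convex_box_set: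
  fixes X :: "nat \<Rightarrow> (real ^ 'n) set" and U :: "nat \<Rightarrow> (real ^ 'm) set"
  assumes "\<And>i. i \<in> {1..CARD('t)} \<Longrightarrow> convex (X i)" "\<And>i. i \<in> {1..CARD('u)} \<Longrightarrow> convex (U i)"
  shows "convex (box_set X U :: ('t::{finite,linorder}, 'n, 'u::{finite,linorder}, 'm) decision set)"
  using assms unfolding box_set_def convex_def
  by (auto simp: state_linear_simps control_linear_simps)

text \<open>Closedness comes from preimages under continuous maps. Boundedness is checked
  coordinatewise, since each coordinate belongs to exactly one stage.\<close>

lemma compact_box_set:
  fixes X :: "nat \<Rightarrow> (real ^ 'n) set" and U :: "nat \<Rightarrow> (real ^ 'm) set"
  assumes X: "\<And>i. i \<in> {1..CARD('t)} \<Longrightarrow> compact (X i)"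
    and U: "\<And>i. i \<in> {1..CARD('u)} \<Longrightarrow> compact (U i)"
  shows "compact (box_set X U :: ('t::{finite,linorder}, 'n, 'u::{finite,linorder}, 'm) decision set)"
    (is "compact ?B")
proof -
  have "closed ((\<lambda>y :: ('t, 'n, 'u, 'm) decision. state y i) -` X i)" if "i \<in> {1..CARD('t)}" for i
    using X[OF that] by (intro closed_vimage compact_imp_closed)
      (auto intro: linear_continuous_on bounded_linear_state)
  moreover have "closed ((\<lambda>y :: ('t, 'n, 'u, 'm) decision. control y i) -` U i)"
    if "i \<in> {1..CARD('u)}" for i
    using U[OF that] by (intro closed_vimage compact_imp_closed)
      (auto intro: linear_continuous_on bounded_linear_control)
  moreover have "?B = (\<Inter>i\<in>{1..CARD('t)}. (\<lambda>y. state y i) -` X i) \<inter>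
      (\<Inter>i\<in>{1..CARD('u)}. (\<lambda>y. control y i) -` U i)"
    unfolding box_set_def by blast
  ultimately have "closed ?B"
    by (simp only:) (intro closed_Int closed_INT ballI, auto)
  moreover have "bounded ?B"
  proof -
    have "bounded ((\<lambda>y. y $ c) ` ?B)" for c
    proof (cases c)
      case (Inl p)
      have i: "stage (fst p) \<in> {1..CARD('t)}" using range_stage by blast
      have "(\<lambda>y. y $ c) ` ?B \<subseteq> (\<lambda>x. x $ snd p) ` X (stage (fst p))"
        using i Inl by (force simp: box_set_def state_def)
      then show ?thesis
        using bounded_component_cart compact_imp_bounded[OF X[OF i]] bounded_subset by blast
    next
      case (Inr p)
      have i: "stage (fst p) \<in> {1..CARD('u)}" using range_stage by blast
      have "(\<lambda>y. y $ c) ` ?B \<subseteq> (\<lambda>x. x $ snd p) ` U (stage (fst p))"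
        using i Inr by (force simp: box_set_def control_def)
      then show ?thesis
        using bounded_component_cart compact_imp_bounded[OF U[OF i]] bounded_subset by blast
    qed
    then have "\<exists>b. \<forall>y\<in>?B. \<bar>y $ c\<bar> \<le> b" for c
      by (simp add: bounded_iff)
    then obtain b where b: "\<And>c y. y \<in> ?B \<Longrightarrow> \<bar>y $ c\<bar> \<le> b c"
      by metis
    \<comment> \<open>The Euclidean norm is at most the sum of the absolute coordinates.\<close>
    have "norm y \<le> sum b UNIV" if "y \<in> ?B" for y
      using norm_le_l1_cart[of y] sum_mono[of UNIV "\<lambda>c. \<bar>y $ c\<bar>" b] b[OF that] by force
    then show ?thesis
      by (auto intro: boundedI)
  qed
  ultimately show ?thesis
    by (simp add: compact_eq_bounded_closed)
qed

lemma C2_deriv: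
  assumes "C2 \<phi>"
  obtains D where "\<And>x. (\<phi> has_derivative blinfun_apply (D x)) (at x)" "continuous_on UNIV D"
proof -
  from assms obtain D D2 where
    "\<forall>x. (\<phi> has_derivative blinfun_apply (D x)) (at x)"
    "\<forall>x. (D has_derivative blinfun_apply (D2 x)) (at x)"
    unfolding C2_def by blast
  then show ?thesis
    by (intro that[of D] continuous_at_imp_continuous_on) (auto intro: has_derivative_continuous)
qed

lemma convex_on_compose_linear:
  assumes "linear L" "convex_on UNIV f"
  shows "convex_on UNIV (\<lambda>x. f (L x))"
  using assms by (auto simp: convex_on_def linear_add linear_cmul)

lemma has_derivative_vec:
  fixes g :: "'a::real_normed_vector \<Rightarrow> real ^ 'k"
  assumes "\<And>j. ((\<lambda>x. g x $ j) has_derivative (\<lambda>v. g' v $ j)) (at x)"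
  shows "(g has_derivative g') (at x)"
  unfolding has_derivative_componentwise_within[of g]
  using assms by (auto simp: Basis_vec_def inner_axis)

text \<open>Each component is a convex function of a linear image of \<open>y\<close>, plus a linear
  term in the dynamics; the chain rule gives the derivative.\<close>

lemma convex_constraints_constr:
  fixes f :: "(real ^ 'n) \<times> (real ^ 'm) \<Rightarrow> real ^ 'n" and h :: "real ^ 'n \<Rightarrow> real ^ 's"
  assumes "C2 f" "\<And>j. convex_on UNIV (\<lambda>p. f p $ j)" "C2 h" "\<And>j. convex_on UNIV (\<lambda>x. h x $ j)"
    and ne: "\<And>j. {y. (constr f h y :: real ^ (('u \<times> 'n) + ('t \<times> 's))) $ j \<le> 0} \<noteq> {}"
  shows "\<exists>q'. convex_constraints (constr f h ::
    ('t::{finite,linorder}, 'n, 'u::{finite,linorder}, 'm) decision \<Rightarrow> _) q'"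
proof -
  obtain Df where Df: "\<And>x. (f has_derivative blinfun_apply (Df x)) (at x)" "continuous_on UNIV Df"
    using C2_deriv[OF assms(1)] by blast
  obtain Dh where Dh: "\<And>x. (h has_derivative blinfun_apply (Dh x)) (at x)" "continuous_on UNIV Dh"
    using C2_deriv[OF assms(3)] by blast
  let ?q = "constr f h :: ('t, 'n, 'u, 'm) decision \<Rightarrow> real ^ (('u \<times> 'n) + ('t \<times> 's))"
  define p :: "nat \<Rightarrow> ('t, 'n, 'u, 'm) decision \<Rightarrow> _" where "p i y = (state y i, control y i)" for i y
  \<comment> \<open>This holds for every \<open>i\<close>: outside the stage range
    \<open>at_stage\<close> still denotes some fixed, unspecified element.\<close>
  have pl: "bounded_linear (p i)" for i
    unfolding p_def by (intro bounded_linear_Pair bounded_linear_state bounded_linear_control)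
  note nth = bounded_linear.has_derivative[OF bounded_linear_vec_nth]
  have f_deriv: "((\<lambda>y. f (p i y) $ a) has_derivative (\<lambda>v. Df (p i y) (p i v) $ a)) (at y)" for i a y
    by (rule nth[OF has_derivative_compose[OF bounded_linear_imp_has_derivative[OF pl] Df(1)]])
  have h_deriv: "((\<lambda>y :: ('t, 'n, 'u, 'm) decision. h (state y i) $ a) has_derivative
      (\<lambda>v. Dh (state y i) (state v i) $ a)) (at y)" for i a y
    by (rule nth[OF has_derivative_compose[OF
          bounded_linear_imp_has_derivative[OF bounded_linear_state] Dh(1)]])
  have s_deriv: "((\<lambda>y :: ('t, 'n, 'u, 'm) decision. state y i $ a) has_derivative
      (\<lambda>v. state v i $ a)) (at y)" for i a y
    by (rule nth[OF bounded_linear_imp_has_derivative[OF bounded_linear_state]])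
  define q' :: "('t, 'n, 'u, 'm) decision \<Rightarrow> ('t, 'n, 'u, 'm) decision \<Rightarrow> real ^ (('u \<times> 'n) + ('t \<times> 's))"
    where "q' y v = (\<chi> j. case j of
        Inl k \<Rightarrow> (let i = stage (fst k) in Df (p i y) (p i v) - state v (i + 1) + state v i) $ snd k
      | Inr k \<Rightarrow> (let i = stage (fst k) in Dh (state y i) (state v i)) $ snd k)" for y v
  \<comment> \<open>Grouped as convex part plus linear part, so that the subtracted state does not
    spoil convexity.\<close>
  have qI: "?q y $ Inl k = f (p (stage (fst k)) y) $ snd k
      + (state y (stage (fst k)) $ snd k - state y (stage (fst k) + 1) $ snd k)" for y k
    by (simp add: constr_def dyn_vec_def dyn_def p_def)
  have qR: "?q y $ Inr k = h (state y (stage (fst k))) $ snd k" for y k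
    by (simp add: constr_def path_vec_def)
  have "convex_constraints ?q q'"
  proof
    show "convex_on UNIV (\<lambda>y. ?q y $ j)" for j
    proof (cases j)
      case (Inl k)
      have "convex_on UNIV (\<lambda>y :: ('t, 'n, 'u, 'm) decision.
          state y (stage (fst k)) $ snd k - state y (stage (fst k) + 1) $ snd k)"
        by (auto simp: convex_on_def state_linear_simps algebra_simps)
      moreover have "convex_on UNIV (\<lambda>y. f (p (stage (fst k)) y) $ snd k)"
        by (rule convex_on_compose_linear[OF bounded_linear.linear[OF pl] assms(2)])
      ultimately show ?thesis
        unfolding Inl qI by (intro convex_on_add)
    next
      case (Inr k)
      show ?thesis
        unfolding Inr qR
        by (rule convex_on_compose_linear[OF bounded_linear.linear[OF bounded_linear_state] assms(4)])
    qed
    show "(?q has_derivative q' y) (at y)" for y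
    proof (rule has_derivative_vec)
      fix j
      show "((\<lambda>y. ?q y $ j) has_derivative (\<lambda>v. q' y v $ j)) (at y)"
      proof (cases j)
        case (Inl k)
        show ?thesis
          unfolding Inl qI using has_derivative_add[OF f_deriv has_derivative_diff[OF s_deriv s_deriv]]
          by (rule has_derivative_eq_rhs) (simp add: q'_def Let_def algebra_simps)
      next
        case (Inr k)
        show ?thesis
          unfolding Inr qR using h_deriv
          by (rule has_derivative_eq_rhs) (simp add: q'_def Let_def)
      qed
    qed
    show "continuous_on UNIV (\<lambda>y. q' y v)" for v
      unfolding q'_def
    proof (rule continuous_on_vec_lambda)
      fix j :: "('u \<times> 'n) + ('t \<times> 's)"
      have "continuous_on UNIV (\<lambda>y. Df (p i y))" for i
        by (intro continuous_on_compose2[OF Df(2)] linear_continuous_on pl) simp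
      moreover have "continuous_on UNIV (\<lambda>y :: ('t, 'n, 'u, 'm) decision. Dh (state y i))" for i
        by (intro continuous_on_compose2[OF Dh(2)] linear_continuous_on bounded_linear_state) simp
      ultimately show "continuous_on UNIV (\<lambda>y. case j of
          Inl k \<Rightarrow> (let i = stage (fst k) in Df (p i y) (p i v) - state v (i + 1) + state v i) $ snd k
        | Inr k \<Rightarrow> (let i = stage (fst k) in Dh (state y i) (state v i)) $ snd k)"
        by (cases j) (simp_all add: Let_def continuous_intros)
    qed
    show "{y. ?q y $ j \<le> 0} \<noteq> {}" for j
      by (rule ne)
  qed
  then show ?thesis by blast
qed

lemma continuous_on_penalty:
  assumes "continuous_on UNIV J" "C2 f"
  shows "continuous_on UNIV (penalty J lam f)"
proof -
  have f: "continuous_on UNIV f"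
    using assms(2) by (auto elim!: C2_deriv
        intro: continuous_at_imp_continuous_on has_derivative_continuous)
  note [continuous_intros] = linear_continuous_on[OF bounded_linear_state]
    linear_continuous_on[OF bounded_linear_control] continuous_on_compose2[OF f]
  show ?thesis
    unfolding penalty_def l1_norm_def dyn_vec_def dyn_def vec_lambda_beta
    by (intro continuous_intros assms(1)) auto
qed

theorem theorem11:
  fixes T :: nat
    and X :: "nat \<Rightarrow> (real ^ 'n) set"
    and U :: "nat \<Rightarrow> (real ^ 'm) set"
    and f :: "(real ^ 'n) \<times> (real ^ 'm) \<Rightarrow> real ^ 'n"
    and h :: "real ^ 'n \<Rightarrow> real ^ 's"
    and J :: "('t::{finite,linorder}, 'n, 'u::{finite,linorder}, 'm) decision \<Rightarrow> real"
    and lam :: real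
    and Y F :: "('t, 'n, 'u, 'm) decision set"
    and q :: "('t, 'n, 'u, 'm) decision \<Rightarrow> real ^ (('u \<times> 'n) + ('t \<times> 's))"
    and P :: "('t, 'n, 'u, 'm) decision \<Rightarrow> real"
    and z :: "nat \<Rightarrow> ('t, 'n, 'u, 'm) decision"
  assumes "T \<ge> 2" and "CARD('t) = T" and "CARD('u) = T - 1"
    and "\<And>i. i \<in> {1..T} \<Longrightarrow> convex (X i) \<and> compact (X i)"
    and "\<And>i. i \<in> {1..T - 1} \<Longrightarrow> convex (U i) \<and> compact (U i)"
    and "C2 f" and "\<And>j. convex_on UNIV (\<lambda>p. f p $ j)"
    and "C2 h" and "\<And>j. convex_on UNIV (\<lambda>x. h x $ j)"
    and "continuous_on UNIV J" and "convex_on UNIV J" and "lam \<ge> 0"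
    and Y: "Y = box_set X U"
    and q: "q = constr f h"
    and P: "P = penalty J lam f"
    and F: "F = feasible Y q"
    and "\<And>j. {y. q y $ j \<le> 0} \<noteq> {}"
    and LICQ: "\<And>w. w \<in> F \<Longrightarrow> rank (jacobian q (at w)) = CARD(('u \<times> 'n) + ('t \<times> 's))"
    and Slater: "\<And>w. w \<in> F \<Longrightarrow> interior (convexified Y q w) \<noteq> {}"
    and "z 0 \<in> F"
    and "\<And>k. is_arg_min P (\<lambda>y. y \<in> convexified Y q (z k)) (z (Suc k))"
  shows "(\<forall>k. z k \<in> F) \<and>
    (\<exists>zs\<in>F. (\<exists>r :: nat \<Rightarrow> nat. strict_mono r \<and> (z \<circ> r) \<longlonglongrightarrow> zs) \<and>
       P zs = (INF k. P (z k)) \<and>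
       P zs = opt_value P Y q zs \<and>
       is_arg_min P (\<lambda>y. y \<in> convexified Y q zs) zs)"
proof -
  obtain q' where "convex_constraints q q'"
    using convex_constraints_constr[OF assms(6-9)] assms(17) q by blast
  then interpret convex_constraints q q' .
  \<comment> \<open>The cardinality assumptions match \<open>{1..T}\<close> and
    \<open>{1..T - 1}\<close> with the index ranges in \<open>box_set\<close>.\<close>
  have "convex Y" "compact Y"
    unfolding Y using assms(2-5) by (auto intro!: convex_box_set compact_box_set)
  moreover have "continuous_on UNIV P"
    unfolding P using assms(6,10) by (rule continuous_on_penalty[rotated])
  ultimately show ?thesis
    using Slater assms(20,21) unfolding F by (intro limit_point_optimal) auto
qed

end
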